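(* Let $\vec w=(w_1,w_2)$ and $\underline{\underline{\vec w}}:=x\vec w=(xw_1,xw_2)$. For $n\in\mathbb N_0$, $$B^{(n)}_{\underline{\underline{\vec w}}}(x)=\frac1x\,\frac{\begin{vmatrix}B^{(n)}_{\vec w}(0)&B^{(n)}_{\vec w}(x)\\ B^{(n+1)}_{\vec w}(0)&B^{(n+1)}_{\vec w}(x)\end{vmatrix}}{B^{(n)}_{\vec w}(0)},\qquad Q^{(n)}_{\underline{\underline{\vec w}}}(x)=\frac1x\,\frac{\begin{vmatrix}A^{(n)}_{\vec w,1}(0)&A^{(n)}_{\vec w,2}(0)&Q^{(n)}_{\vec w}(x)\\ A^{(n+1)}_{\vec w,1}(0)&A^{(n+1)}_{\vec w,2}(0)&Q^{(n+1)}_{\vec w}(x)\\ A^{(n+2)}_{\vec w,1}(0)&A^{(n+2)}_{\vec w,2}(0)&Q^{(n+2)}_{\vec w}(x)\end{vmatrix}}{\begin{vmatrix}A^{(n+1)}_{\vec w,1}(0)&A^{(n+1)}_{\vec w,2}(0)\\ A^{(n+2)}_{\vec w,1}(0)&A^{(n+2)}_{\vec w,2}(0)\end{vmatrix}} .$$ Moreover, if $T_{\vec w}=\Omega\,\omega$ is the $LU$ factorization of the recursion matrix of the original system ($\Omega$ lower unitriangular, $\omega$ upper triangular), then $T_{\underline{\underline{\vec w}}}=\omega\,\Omega$.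
   Context: Let $\Delta\subset\mathbb R$ be an interval, $\mu$ a measure supported on $\Delta$, and $w_1,w_2$ weight functions on $\Delta$ with all moments finite. All vectors and matrices are semi-infinite, indexed by $0,1,2,\dots$. Put $X(x)=(1,x,x^2,\dots)^\top$, $X_1(x)=(1,0,x,0,x^2,0,\dots)^\top$, $X_2(x)=(0,1,0,x,0,x^2,\dots)^\top$. For a pair of weights $\vec u=(u_1,u_2)$, the moment matrix is $g_{\vec u}=\int_\Delta X(x)\big(X_1(x)u_1(x)+X_2(x)u_2(x)\big)^\top\mathrm d\mu(x)$. It is assumed that for both $\vec u=\vec w$ and $\vec u=\underline{\underline{\vec w}}$ the matrix $g_{\vec u}$ has a Gauss–Borel factorization $g_{\vec u}=S_{\vec u}^{-1}H_{\vec u}\tilde S_{\vec u}^{-\top}$ with $S_{\vec u},\tilde S_{\vec u}$ lower unitriangular and $H_{\vec u}$ diagonal with nonzero entries. $B^{(n)}_{\vec u}$, $A^{(n)}_{\vec u,a}$, $Q^{(n)}_{\vec u}$ are the entries of $B_{\vec u}=S_{\vec u}X$ (type II polynomials), $A_{\vec u,a}=H_{\vec u}^{-1}\tilde S_{\vec u}X_a$, $a\in\{1,2\}$ (type I polynomials), and $Q_{\vec u}=u_1A_{\vec u,1}+u_2A_{\vec u,2}$ (linear forms). The recursion matrix is $T_{\vec u}=S_{\vec u}\Lambda S_{\vec u}^{-1}$, where $\Lambda$ has ones on the first superdiagonal and zeros elsewhere. Standing assumption: the zeros of the type II orthogonal polynomials belong to the interior of $\Delta$, and $0$ does not belong to the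 interior of $\Delta$.
   Formalization: The printed factor 1/x in the Q-formula is false for Q_u = u1 A_{u,1} + u2 A_{u,2} at u = xw; the formal statement proves Q_{xw} = quotient of determinants without 1/x, and the printed right-hand side for w1 A_{xw,1} + w2 A_{xw,2} instead. *)

theory Defs
  imports
    "HOL-Analysis.Analysis"
    "HOL-Computational_Algebra.Polynomial"
    "HOL-Library.Groups_Big_Fun"
begin

section \<open>Semi-infinite matrices\<close>

text \<open>
  Matrices and vectors are indexed by \<open>0, 1, 2, \<dots>\<close>. \<open>Sum_any\<close> adds up a family with finitely many
  nonzero members (and is \<open>0\<close> otherwise). All products formed below have entries that are
  finite sums; for the product of an upper and a lower triangular factor this holds because the upper
  factor of a matrix vanishing above the first superdiagonal vanishes there as well.
\<close>

type_synonym smat = "nat \<Rightarrow> nat \<Rightarrow> real"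

definition smat_mult :: "smat \<Rightarrow> smat \<Rightarrow> smat"  (infixl "\<odot>" 70) where
  "M \<odot> N = (\<lambda>i j. Sum_any (\<lambda>k. M i k * N k j))"

definition smat_vec :: "smat \<Rightarrow> (nat \<Rightarrow> real poly) \<Rightarrow> nat \<Rightarrow> real poly"  (infixr "\<odot>v" 69) where
  "M \<odot>v v = (\<lambda>i. Sum_any (\<lambda>k. smult (M i k) (v k)))"

definition smat_one :: smat where
  "smat_one = (\<lambda>i j. if i = j then 1 else 0)"

definition smat_transpose :: "smat \<Rightarrow> smat" where
  "smat_transpose M = (\<lambda>i j. M j i)"

text \<open>
  Only applied to lower unitriangular matrices and to diagonal matrices with nonzero diagonal, where
  the two-sided inverse exists and is unique.
\<close>

definition smat_inv :: "smat \<Rightarrow> smat" where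
  "smat_inv M = (THE N. M \<odot> N = smat_one \<and> N \<odot> M = smat_one)"

definition lower_unitriangular :: "smat \<Rightarrow> bool" where
  "lower_unitriangular M \<longleftrightarrow> (\<forall>i. M i i = 1) \<and> (\<forall>i j. i < j \<longrightarrow> M i j = 0)"

definition upper_triangular :: "smat \<Rightarrow> bool" where
  "upper_triangular M \<longleftrightarrow> (\<forall>i j. j < i \<longrightarrow> M i j = 0)"

definition nonzero_diagonal :: "smat \<Rightarrow> bool" where
  "nonzero_diagonal M \<longleftrightarrow> (\<forall>i. M i i \<noteq> 0) \<and> (\<forall>i j. i \<noteq> j \<longrightarrow> M i j = 0)"

definition shift :: smat where
  "shift = (\<lambda>i j. if j = Suc i then 1 else 0)"

definition gauss_borel :: "smat \<Rightarrow> smat \<Rightarrow> smat \<Rightarrow> smat \<Rightarrow> bool" where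
  "gauss_borel g S H St \<longleftrightarrow>
     lower_unitriangular S \<and> nonzero_diagonal H \<and> lower_unitriangular St \<and>
     g = smat_inv S \<odot> H \<odot> smat_transpose (smat_inv St)"

section \<open>Moments and multiple orthogonal polynomials\<close>

definition X :: "nat \<Rightarrow> real poly" where
  "X k = monom 1 k"

definition X1 :: "nat \<Rightarrow> real poly" where
  "X1 k = (if even k then monom 1 (k div 2) else 0)"

definition X2 :: "nat \<Rightarrow> real poly" where
  "X2 k = (if odd k then monom 1 (k div 2) else 0)"

definition finite_moments :: "real measure \<Rightarrow> real set \<Rightarrow> (real \<Rightarrow> real) \<Rightarrow> bool" where
  "finite_moments \<mu> \<Delta> w \<longleftrightarrow> (\<forall>k::nat. set_integrable \<mu> \<Delta> (\<lambda>x. x ^ k * w x))"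

definition moment_matrix ::
  "real measure \<Rightarrow> real set \<Rightarrow> (real \<Rightarrow> real) \<Rightarrow> (real \<Rightarrow> real) \<Rightarrow> smat" where
  "moment_matrix \<mu> \<Delta> u1 u2 = (\<lambda>i j.
     LINT x:\<Delta>|\<mu>. poly (X i) x * (poly (X1 j) x * u1 x + poly (X2 j) x * u2 x))"

definition typeII :: "smat \<Rightarrow> nat \<Rightarrow> real poly" where
  "typeII S = S \<odot>v X"

definition typeI_1 :: "smat \<Rightarrow> smat \<Rightarrow> nat \<Rightarrow> real poly" where
  "typeI_1 H St = (smat_inv H \<odot> St) \<odot>v X1"

definition typeI_2 :: "smat \<Rightarrow> smat \<Rightarrow> nat \<Rightarrow> real poly" where
  "typeI_2 H St = (smat_inv H \<odot> St) \<odot>v X2"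

definition linear_form ::
  "(real \<Rightarrow> real) \<Rightarrow> (real \<Rightarrow> real) \<Rightarrow> smat \<Rightarrow> smat \<Rightarrow> nat \<Rightarrow> real \<Rightarrow> real" where
  "linear_form u1 u2 H St n x = u1 x * poly (typeI_1 H St n) x + u2 x * poly (typeI_2 H St n) x"

definition recursion_matrix :: "smat \<Rightarrow> smat" where
  "recursion_matrix S = S \<odot> shift \<odot> smat_inv S"

definition det2 :: "real \<Rightarrow> real \<Rightarrow> real \<Rightarrow> real \<Rightarrow> real" where
  "det2 a b c d = det (vector [vector [a, b], vector [c, d]] :: real ^ 2 ^ 2)"

definition det3 ::
  "real \<Rightarrow> real \<Rightarrow> real \<Rightarrow> real \<Rightarrow> real \<Rightarrow> real \<Rightarrow> real \<Rightarrow> real \<Rightarrow> real \<Rightarrow> real" where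
  "det3 a b c d e f g h i =
     det (vector [vector [a, b, c], vector [d, e, f], vector [g, h, i]] :: real ^ 3 ^ 3)"

text \<open>
  The perturbed linear form \<open>x w\<^sub>1 A\<^sub>1 + x w\<^sub>2 A\<^sub>2\<close> contains the factor \<open>x\<close> of the perturbed weights,
  so it equals the quotient of the following two determinants without a prefactor \<open>1 / x\<close>. The
  prefactor appears when the perturbed type I polynomials are paired with the weights \<open>w\<^sub>1, w\<^sub>2\<close>
  (the factor \<open>x\<close> being attributed to the measure).
\<close>

definition typeI_minor :: "smat \<Rightarrow> smat \<Rightarrow> nat \<Rightarrow> real" where
  "typeI_minor H St n =
     det2 (poly (typeI_1 H St (n + 1)) 0) (poly (typeI_2 H St (n + 1)) 0)
          (poly (typeI_1 H St (n + 2)) 0) (poly (typeI_2 H St (n + 2)) 0)"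

definition linear_form_det ::
  "(real \<Rightarrow> real) \<Rightarrow> (real \<Rightarrow> real) \<Rightarrow> smat \<Rightarrow> smat \<Rightarrow> nat \<Rightarrow> real \<Rightarrow> real" where
  "linear_form_det w1 w2 H St n x =
     det3 (poly (typeI_1 H St n) 0) (poly (typeI_2 H St n) 0) (linear_form w1 w2 H St n x)
          (poly (typeI_1 H St (n + 1)) 0) (poly (typeI_2 H St (n + 1)) 0)
            (linear_form w1 w2 H St (n + 1) x)
          (poly (typeI_1 H St (n + 2)) 0) (poly (typeI_2 H St (n + 2)) 0)
            (linear_form w1 w2 H St (n + 2) x)"

end

theory Submission
  imports Defs
begin

text \<open>
  Multiplication of both weights by \<open>x\<close> acts on the moment matrix \<open>g\<close> as \<open>\<Lambda> g\<close> and on its transpose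
  as \<open>\<Lambda>\<^sup>2 g\<^sup>T\<close>, and transposition exchanges the roles of \<open>S\<close> and \<open>St\<close> in the Gauss--Borel
  factorization. Comparing the factorizations of \<open>g'\<close> and \<open>P g\<close> shows that \<open>K = S' P S\<^sup>-\<^sup>1\<close>
  satisfies \<open>K H = H' (St St'\<^sup>-\<^sup>1)\<^sup>T\<close>: its right-hand side is upper triangular and \<open>K\<close> is banded above
  the diagonal, so \<open>K\<close> yields a short relation \<open>x v' = K v\<close> between the perturbed and the original
  polynomials. For \<open>P = \<Lambda>\<close> this relates \<open>B\<close> to two consecutive \<open>B\<close>'s; for \<open>P = \<Lambda>\<^sup>2\<close> it relates type I
  polynomials to three consecutive ones. Putting \<open>x = 0\<close> and eliminating the coefficients gives the
  determinantal formulas. The type I minors do not vanish because consecutive minors are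
  proportional and the first minor is \<open>1 / (H\<^sub>0 H\<^sub>1)\<close>. Finally
  \<open>T = S \<Lambda> S\<^sup>-\<^sup>1 = (S S'\<^sup>-\<^sup>1) (S' \<Lambda> S\<^sup>-\<^sup>1)\<close> is the LU factorization, and swapping its factors gives
  \<open>S' \<Lambda> S'\<^sup>-\<^sup>1\<close>.
\<close>

section \<open>Row-finite and banded matrices\<close>

text \<open>\<open>Sum_any\<close> is 0 on infinite supports, so product laws need a finiteness
  condition; this one covers all lower triangular, diagonal and banded factors.\<close>

definition row_finite :: "smat \<Rightarrow> bool" where
  "row_finite M \<longleftrightarrow> (\<forall>i. finite {k. M i k \<noteq> 0})"

text \<open>Treats lower unitriangular matrices (\<open>p = 0\<close>) and powers of
  \<open>shift\<close> alike; the ones on the outermost superdiagonal survive in products.\<close>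

definition unibanded :: "nat \<Rightarrow> smat \<Rightarrow> bool" where
  "unibanded p M \<longleftrightarrow> (\<forall>i. M i (i + p) = 1) \<and> (\<forall>i j. i + p < j \<longrightarrow> M i j = 0)"

lemma lower_unitriangular_iff_unibanded: "lower_unitriangular M \<longleftrightarrow> unibanded 0 M"
  by (simp add: lower_unitriangular_def unibanded_def)

lemma row_finiteI: "(\<And>i k. f i < k \<Longrightarrow> M i k = 0) \<Longrightarrow> row_finite M"
  for f :: "nat \<Rightarrow> nat"
  unfolding row_finite_def by (metis (mono_tags, lifting) finite_nat_set_iff_bounded_le mem_Collect_eq not_le)

lemma unibanded_row_finite: "unibanded p M \<Longrightarrow> row_finite M"
  by (rule row_finiteI[where f = "\<lambda>i. i + p"]) (simp add: unibanded_def)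

lemma lower_unitriangular_row_finite: "lower_unitriangular M \<Longrightarrow> row_finite M"
  by (simp add: lower_unitriangular_iff_unibanded unibanded_row_finite)

lemma nonzero_diagonal_row_finite: "nonzero_diagonal M \<Longrightarrow> row_finite M"
  by (rule row_finiteI[where f = id]) (simp add: nonzero_diagonal_def)

lemma unibanded_shift: "unibanded 1 shift"
  by (simp add: unibanded_def shift_def)

lemma smat_mult_eq_sum:
  assumes "finite A" "\<And>k. k \<notin> A \<Longrightarrow> M i k * N k j = 0"
  shows "(M \<odot> N) i j = (\<Sum>k\<in>A. M i k * N k j)"
  unfolding smat_mult_def using assms by (intro Sum_any.expand_superset) auto

lemma smat_vec_eq_sum:
  assumes "finite A" "\<And>k. k \<notin> A \<Longrightarrow> M i k = 0"
  shows "(M \<odot>v v) i = (\<Sum>k\<in>A. smult (M i k) (v k))"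
  unfolding smat_vec_def using assms by (intro Sum_any.expand_superset) auto

lemma smat_mult_diagonal_right:
  assumes "\<And>i j. i \<noteq> j \<Longrightarrow> D i j = 0"
  shows "(M \<odot> D) i j = M i j * D j j"
  using smat_mult_eq_sum[of "{j}" M i D j] assms by auto

lemma smat_mult_diagonal_left:
  assumes "\<And>i j. i \<noteq> j \<Longrightarrow> D i j = 0"
  shows "(D \<odot> M) i j = D i i * M i j"
  using smat_mult_eq_sum[of "{i}" D i M j] assms by auto

lemma smat_mult_one_right [simp]: "M \<odot> smat_one = M"
  by (intro ext, subst smat_mult_diagonal_right) (simp_all add: smat_one_def)

lemma smat_mult_one_left [simp]: "smat_one \<odot> M = M"
  by (intro ext, subst smat_mult_diagonal_left) (simp_all add: smat_one_def)

lemma smat_transpose_mult: "smat_transpose (M \<odot> N) = smat_transpose N \<odot> smat_transpose M"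
  by (simp add: smat_transpose_def smat_mult_def mult.commute)

lemma smat_transpose_transpose [simp]: "smat_transpose (smat_transpose M) = M"
  by (simp add: smat_transpose_def)

lemma smat_transpose_one [simp]: "smat_transpose smat_one = smat_one"
  by (intro ext) (simp add: smat_transpose_def smat_one_def)

lemma smat_transpose_diagonal: "nonzero_diagonal D \<Longrightarrow> smat_transpose D = D"
  by (intro ext, unfold smat_transpose_def nonzero_diagonal_def) metis

lemma unibanded_mult:
  assumes M: "unibanded p M" and N: "unibanded q N"
  shows "unibanded (p + q) (M \<odot> N)"
proof -
  have E: "(M \<odot> N) i j = (\<Sum>k\<le>i + p. M i k * N k j)" for i j
    using M by (intro smat_mult_eq_sum) (auto simp: unibanded_def not_le)
  have "(M \<odot> N) i (i + (p + q)) = (\<Sum>k\<in>{i + p}. M i k * N k (i + (p + q)))" for i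
    unfolding E using N by (intro sum.mono_neutral_right) (auto simp: unibanded_def)
  moreover have "(M \<odot> N) i j = 0" if "i + (p + q) < j" for i j
    unfolding E using N that by (intro sum.neutral) (auto simp: unibanded_def)
  moreover have "N (i + p) (i + (p + q)) = 1" for i
    using N unfolding unibanded_def by (metis add.assoc)
  ultimately show ?thesis using M by (simp add: unibanded_def)
qed

lemma row_finite_mult:
  assumes "row_finite M" "row_finite N"
  shows "row_finite (M \<odot> N)"
  unfolding row_finite_def
proof
  fix i
  have "(M \<odot> N) i j = (\<Sum>k\<in>{k. M i k \<noteq> 0}. M i k * N k j)" for j
    using assms by (intro smat_mult_eq_sum) (auto simp: row_finite_def)
  then have "{j. (M \<odot> N) i j \<noteq> 0} \<subseteq> (\<Union>k\<in>{k. M i k \<noteq> 0}. {j. N k j \<noteq> 0})"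
    by (fastforce intro: sum.neutral)
  then show "finite {j. (M \<odot> N) i j \<noteq> 0}"
    by (rule finite_subset) (use assms in \<open>auto simp: row_finite_def\<close>)
qed

section \<open>Associativity\<close>

text \<open>Interchanges two finite sums. Only the products \<open>B k l * C l j\<close> must vanish
  outside \<open>J\<close>, so \<open>J\<close> may come from rows of \<open>B\<close> or from a
  column of \<open>C\<close>.\<close>

lemma smat_mult_assoc_aux:
  assumes A: "finite I" "\<And>k. k \<notin> I \<Longrightarrow> A i k = 0"
    and J: "finite J" "\<And>k l. k \<in> I \<Longrightarrow> l \<notin> J \<Longrightarrow> B k l * C l j = 0"
  shows "((A \<odot> B) \<odot> C) i j = (A \<odot> (B \<odot> C)) i j"
proof -
  have AB: "(A \<odot> B) i l = (\<Sum>k\<in>I. A i k * B k l)" for l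
    using A by (intro smat_mult_eq_sum) auto
  have BC: "(B \<odot> C) k j = (\<Sum>l\<in>J. B k l * C l j)" if "k \<in> I" for k
    using J that by (intro smat_mult_eq_sum) auto
  have "((A \<odot> B) \<odot> C) i j = (\<Sum>l\<in>J. (A \<odot> B) i l * C l j)"
  proof (rule smat_mult_eq_sum[OF J(1)])
    fix l assume "l \<notin> J"
    then have "A i k * B k l * C l j = 0" if "k \<in> I" for k
      using J(2)[OF that] by simp
    then show "(A \<odot> B) i l * C l j = 0"
      unfolding AB sum_distrib_right by (rule sum.neutral[OF ballI])
  qed
  also have "\<dots> = (\<Sum>k\<in>I. A i k * (B \<odot> C) k j)"
    unfolding AB sum_distrib_right by (subst sum.swap) (simp add: BC sum_distrib_left mult.assoc)
  also have "\<dots> = (A \<odot> (B \<odot> C)) i j"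
    using A by (intro smat_mult_eq_sum[symmetric]) auto
  finally show ?thesis .
qed

lemma smat_mult_assoc:
  assumes "row_finite A" "row_finite B"
  shows "(A \<odot> B) \<odot> C = A \<odot> (B \<odot> C)"
proof (intro ext)
  fix i j
  show "((A \<odot> B) \<odot> C) i j = (A \<odot> (B \<odot> C)) i j"
    using assms
    by (intro smat_mult_assoc_aux[where I = "{k. A i k \<noteq> 0}" and J = "\<Union>k\<in>{k. A i k \<noteq> 0}. {l. B k l \<noteq> 0}"])
       (auto simp: row_finite_def)
qed

text \<open>Here \<open>B\<close> is arbitrary, as is needed for the upper triangular factors of a Gauss--Borel factorization.\<close>

lemma smat_mult_assoc_outer:
  assumes "row_finite A" "row_finite (smat_transpose C)"
  shows "(A \<odot> B) \<odot> C = A \<odot> (B \<odot> C)"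
proof (intro ext)
  fix i j
  show "((A \<odot> B) \<odot> C) i j = (A \<odot> (B \<odot> C)) i j"
    using assms
    by (intro smat_mult_assoc_aux[where I = "{k. A i k \<noteq> 0}" and J = "{l. C l j \<noteq> 0}"])
       (auto simp: row_finite_def smat_transpose_def)
qed

lemma smult_sum_right: "smult a (\<Sum>i\<in>I. f i) = (\<Sum>i\<in>I. smult a (f i))"
  by (induction I rule: infinite_finite_induct) (simp_all add: smult_add_right)

lemma smat_vec_assoc:
  assumes "row_finite A" "row_finite B"
  shows "(A \<odot> B) \<odot>v v = A \<odot>v (B \<odot>v v)"
proof
  fix i
  define I where "I = {k. A i k \<noteq> 0}"
  define J where "J = (\<Union>k\<in>I. {l. B k l \<noteq> 0})"
  have fin: "finite I" "finite J"
    using assms by (auto simp: row_finite_def I_def J_def)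
  have AB: "(A \<odot> B) i l = (\<Sum>k\<in>I. A i k * B k l)" for l
    using fin by (intro smat_mult_eq_sum) (auto simp: I_def)
  have Bv: "(B \<odot>v v) k = (\<Sum>l\<in>J. smult (B k l) (v l))" if "k \<in> I" for k
    using fin that by (intro smat_vec_eq_sum) (auto simp: J_def)
  have "((A \<odot> B) \<odot>v v) i = (\<Sum>l\<in>J. smult ((A \<odot> B) i l) (v l))"
    using fin by (intro smat_vec_eq_sum) (auto simp: AB J_def intro!: sum.neutral)
  also have "\<dots> = (\<Sum>l\<in>J. \<Sum>k\<in>I. smult (A i k * B k l) (v l))"
    by (simp add: AB smult_sum)
  also have "\<dots> = (\<Sum>k\<in>I. smult (A i k) ((B \<odot>v v) k))"
    by (subst sum.swap) (simp add: Bv smult_sum_right)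
  also have "\<dots> = (A \<odot>v (B \<odot>v v)) i"
    using fin by (intro smat_vec_eq_sum[symmetric]) (auto simp: I_def)
  finally show "((A \<odot> B) \<odot>v v) i = (A \<odot>v (B \<odot>v v)) i" .
qed

lemma smat_vec_mult_poly:
  assumes "row_finite A"
  shows "(A \<odot>v (\<lambda>k. q * v k)) i = q * (A \<odot>v v) i"
proof -
  have "(A \<odot>v u) i = (\<Sum>k\<in>{k. A i k \<noteq> 0}. smult (A i k) (u k))" for u
    using assms by (intro smat_vec_eq_sum) (auto simp: row_finite_def)
  then show ?thesis by (simp add: sum_distrib_left)
qed

section \<open>Inverses of unitriangular and diagonal matrices\<close>

text \<open>Any inverse \<open>N'\<close> satisfies
  \<open>N' = (N \<odot> M) \<odot> N' = N \<odot> (M \<odot> N') = N\<close>. The regrouping asks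
  nothing of \<open>N'\<close>, so uniqueness holds among all matrices.\<close>

lemma smat_inv_eqI:
  assumes "row_finite M" "row_finite N" "M \<odot> N = smat_one" "N \<odot> M = smat_one"
  shows "smat_inv M = N"
  unfolding smat_inv_def
proof (rule the_equality)
  fix N' assume "M \<odot> N' = smat_one \<and> N' \<odot> M = smat_one"
  then show "N' = N"
    using smat_mult_assoc[OF assms(2,1), of N'] assms(4) by simp
qed (use assms in simp)

text \<open>Solves \<open>M \<odot> N = smat_one\<close> row by row for unitriangular
  \<open>M\<close>, hence without division. As a simp rule its equation would loop.\<close>

fun forward_substitution :: "smat \<Rightarrow> smat" where
  "forward_substitution M i j =
     (if i = j then 1 else 0) - (\<Sum>k<i. M i k * forward_substitution M k j)"

declare forward_substitution.simps [simp del]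

lemma forward_substitution_lower:
  "i < j \<Longrightarrow> forward_substitution M i j = 0"
proof (induction i rule: less_induct)
  case (less i)
  then show ?case by (subst forward_substitution.simps) simp
qed

lemma forward_substitution_diagonal: "forward_substitution M i i = 1"
  by (subst forward_substitution.simps) (simp add: forward_substitution_lower)

lemma unibanded_forward_substitution: "unibanded 0 (forward_substitution M)"
  by (simp add: unibanded_def forward_substitution_lower forward_substitution_diagonal)

lemma mult_forward_substitution:
  assumes "unibanded 0 M"
  shows "M \<odot> forward_substitution M = smat_one"
proof (intro ext)
  fix i j
  have "(M \<odot> forward_substitution M) i j = (\<Sum>k\<le>i. M i k * forward_substitution M k j)"
    using assms by (intro smat_mult_eq_sum) (auto simp: unibanded_def not_le)
  also have "{..i} = insert i {..<i}"
    by auto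
  also have "(\<Sum>k\<in>insert i {..<i}. M i k * forward_substitution M k j) = smat_one i j"
    using assms by (subst sum.insert) (simp_all, subst forward_substitution.simps,
        simp add: unibanded_def smat_one_def)
  finally show "(M \<odot> forward_substitution M) i j = smat_one i j" .
qed

text \<open>\<open>M\<close> has a right inverse \<open>N\<close>, which has a right inverse
  \<open>P\<close>; then \<open>M = M \<odot> (N \<odot> P) = P\<close>, so \<open>N\<close> is
  two-sided.\<close>

lemma smat_inv_unibanded:
  assumes M: "unibanded 0 M"
  shows "unibanded 0 (smat_inv M)" "M \<odot> smat_inv M = smat_one" "smat_inv M \<odot> M = smat_one"
proof -
  define N where "N = forward_substitution M"
  define P where "P = forward_substitution N"
  have N: "unibanded 0 N" "M \<odot> N = smat_one"
    using mult_forward_substitution[OF M] by (simp_all add: N_def unibanded_forward_substitution)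
  have NP: "N \<odot> P = smat_one"
    using mult_forward_substitution[OF N(1)] by (simp add: P_def)
  have "M = P"
    using smat_mult_assoc[of M N P] NP N M by (simp add: unibanded_row_finite)
  then have "N \<odot> M = smat_one"
    using NP by simp
  then have "smat_inv M = N"
    using M N by (intro smat_inv_eqI) (simp_all add: unibanded_row_finite)
  with N \<open>N \<odot> M = smat_one\<close>
  show "unibanded 0 (smat_inv M)" "M \<odot> smat_inv M = smat_one" "smat_inv M \<odot> M = smat_one"
    by simp_all
qed

lemma smat_inv_row_finite: "unibanded 0 M \<Longrightarrow> row_finite (smat_inv M)"
  by (rule unibanded_row_finite[OF smat_inv_unibanded(1)])

lemma smat_inv_diagonal:
  assumes "nonzero_diagonal D"
  shows "smat_inv D = (\<lambda>i j. if i = j then 1 / D i i else 0)"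
proof (rule smat_inv_eqI)
  show "D \<odot> (\<lambda>i j. if i = j then 1 / D i i else 0) = smat_one"
    using assms by (intro ext, subst smat_mult_diagonal_right)
      (auto simp: nonzero_diagonal_def smat_one_def)
  show "(\<lambda>i j. if i = j then 1 / D i i else 0) \<odot> D = smat_one"
    using assms by (intro ext, subst smat_mult_diagonal_left)
      (auto simp: nonzero_diagonal_def smat_one_def)
qed (use assms in \<open>auto intro: nonzero_diagonal_row_finite simp: nonzero_diagonal_def\<close>)

lemma smat_inv_diagonal_mult_vec:
  assumes D: "nonzero_diagonal D" and "row_finite M"
  shows "((smat_inv D \<odot> M) \<odot>v v) n = smult (1 / D n n) ((M \<odot>v v) n)"
proof -
  have "row_finite (smat_inv D)"
    using D by (intro nonzero_diagonal_row_finite) (auto simp: smat_inv_diagonal nonzero_diagonal_def)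
  then have "((smat_inv D \<odot> M) \<odot>v v) n = (smat_inv D \<odot>v (M \<odot>v v)) n"
    using assms by (simp add: smat_vec_assoc)
  also have "\<dots> = (\<Sum>k\<in>{n}. smult (smat_inv D n k) ((M \<odot>v v) k))"
    using D by (intro smat_vec_eq_sum) (auto simp: smat_inv_diagonal)
  finally show ?thesis
    using D by (simp add: smat_inv_diagonal)
qed

section \<open>Gauss-Borel factorizations and connecting matrices\<close>

lemma gauss_borel_transpose:
  assumes "gauss_borel g S H St"
  shows "gauss_borel (smat_transpose g) St H S"
proof -
  note g = assms[unfolded gauss_borel_def]
  have "row_finite (smat_inv St)" "row_finite H"
    using g by (simp_all add: lower_unitriangular_iff_unibanded smat_inv_row_finite
        nonzero_diagonal_row_finite)
  then have "smat_transpose g = smat_inv St \<odot> H \<odot> smat_transpose (smat_inv S)"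
    using g by (simp add: smat_transpose_mult smat_transpose_diagonal smat_mult_assoc)
  then show ?thesis
    using g by (simp add: gauss_borel_def)
qed

definition connector :: "smat \<Rightarrow> smat \<Rightarrow> smat \<Rightarrow> smat" where
  "connector S P S' = S' \<odot> P \<odot> smat_inv S"

lemma unibanded_connector:
  assumes "unibanded 0 S" "unibanded p P" "unibanded 0 S'"
  shows "unibanded p (connector S P S')"
  using unibanded_mult[OF unibanded_mult[OF assms(3,2)] smat_inv_unibanded(1)[OF assms(1)]]
  by (simp add: connector_def)

lemma connector_mult:
  assumes "unibanded 0 S" "row_finite P" "unibanded 0 S'"
  shows "connector S P S' \<odot> S = S' \<odot> P"
  using assms
  by (simp add: connector_def smat_mult_assoc row_finite_mult unibanded_row_finite
      smat_inv_row_finite smat_inv_unibanded)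

text \<open>With \<open>K\<close> the connector and \<open>V\<close>, \<open>V'\<close> the inverse
  transposes of \<open>St\<close>, \<open>St'\<close>:
  \<open>K H V = K S g = S' P g = S' g' = H' V'\<close>, and \<open>V\<close> is then cancelled from
  the right.\<close>

lemma gauss_borel_connector:
  assumes g: "gauss_borel g S H St" and g': "gauss_borel g' S' H' St'"
    and P: "unibanded p P" and Pg: "g' = P \<odot> g"
  shows "connector S P S' i j * H j j = H' i i * (St \<odot> smat_inv St') j i"
proof -
  let ?K = "connector S P S'"
  have U: "unibanded 0 S" "unibanded 0 S'" "unibanded 0 St" "unibanded 0 St'"
    and D: "nonzero_diagonal H" "nonzero_diagonal H'"
    using g g' by (simp_all add: gauss_borel_def lower_unitriangular_iff_unibanded)
  have K: "unibanded p ?K"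
    by (rule unibanded_connector[OF U(1) P U(2)])
  have rf: "row_finite S" "row_finite S'" "row_finite St" "row_finite St'" "row_finite P"
      "row_finite ?K" "row_finite H" "row_finite H'"
      "row_finite (smat_inv S)" "row_finite (smat_inv S')"
    using U D P K smat_inv_unibanded(1)
    by (blast intro: unibanded_row_finite nonzero_diagonal_row_finite)+
  let ?V = "smat_transpose (smat_inv St)" and ?V' = "smat_transpose (smat_inv St')"
  have "g = smat_inv S \<odot> (H \<odot> ?V)"
    using g rf by (simp add: gauss_borel_def smat_mult_assoc)
  then have Sg: "S \<odot> g = H \<odot> ?V"
    using smat_mult_assoc[OF rf(1,9), of "H \<odot> ?V"] U by (simp add: smat_inv_unibanded)
  have "g' = smat_inv S' \<odot> (H' \<odot> ?V')"
    using g' rf by (simp add: gauss_borel_def smat_mult_assoc)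
  then have Sg': "S' \<odot> g' = H' \<odot> ?V'"
    using smat_mult_assoc[OF rf(2,10), of "H' \<odot> ?V'"] U by (simp add: smat_inv_unibanded)
  have "(?K \<odot> H) \<odot> ?V = (?K \<odot> S) \<odot> g"
    using rf by (simp add: smat_mult_assoc Sg)
  also have "\<dots> = H' \<odot> ?V'"
    using rf U by (simp add: connector_mult smat_mult_assoc Pg[symmetric] Sg')
  finally have "((?K \<odot> H) \<odot> ?V) \<odot> smat_transpose St = (H' \<odot> ?V') \<odot> smat_transpose St"
    by simp
  \<comment> \<open>The upper triangular \<open>?V\<close> need not be row-finite; regrouping rests
    on the finite columns of the transpose of \<open>St\<close>.\<close>
  then have "(?K \<odot> H) \<odot> (?V \<odot> smat_transpose St) = H' \<odot> (?V' \<odot> smat_transpose St)"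
    using rf by (simp add: smat_mult_assoc_outer row_finite_mult)
  then have "?K \<odot> H = H' \<odot> smat_transpose (St \<odot> smat_inv St')"
    using U by (simp add: smat_transpose_mult[symmetric] smat_inv_unibanded)
  then have "(?K \<odot> H) i j = (H' \<odot> smat_transpose (St \<odot> smat_inv St')) i j"
    by simp
  then show ?thesis
    using D by (simp add: smat_mult_diagonal_left smat_mult_diagonal_right nonzero_diagonal_def
        smat_transpose_def)
qed

text \<open>\<open>St \<odot> smat_inv St'\<close> is lower unitriangular and enters with its
  indices swapped, so dividing by \<open>H j j\<close> gives both claims.\<close>

lemma gauss_borel_connector_diagonal:
  assumes g: "gauss_borel g S H St" and g': "gauss_borel g' S' H' St'"
    and P: "unibanded p P" and Pg: "g' = P \<odot> g"
  shows "connector S P S' i i = H' i i / H i i" "j < i \<Longrightarrow> connector S P S' i j = 0"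
proof -
  have U: "unibanded 0 St" "unibanded 0 St'" and D: "nonzero_diagonal H"
    using g g' by (simp_all add: gauss_borel_def lower_unitriangular_iff_unibanded)
  have L: "unibanded 0 (St \<odot> smat_inv St')"
    using unibanded_mult[OF U(1) smat_inv_unibanded(1)[OF U(2)]] by simp
  note C = gauss_borel_connector[OF assms]
  show "connector S P S' i i = H' i i / H i i"
    using C[of i i] L D by (simp add: unibanded_def nonzero_diagonal_def field_simps)
  show "connector S P S' i j = 0" if "j < i"
    using C[of i j] L D that by (simp add: unibanded_def nonzero_diagonal_def)
qed

lemma connector_vec:
  assumes S: "unibanded 0 S" "unibanded 0 S'" and P: "row_finite P"
    and q: "P \<odot>v v = (\<lambda>k. q * v k)"
  shows "q * (S' \<odot>v v) n = (connector S P S' \<odot>v (S \<odot>v v)) n"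
proof -
  have rf: "row_finite S" "row_finite S'" "row_finite (connector S P S')"
    using S P by (simp_all add: unibanded_row_finite connector_def row_finite_mult smat_inv_row_finite)
  have "(connector S P S' \<odot>v (S \<odot>v v)) n = ((S' \<odot> P) \<odot>v v) n"
    using rf S P by (simp add: smat_vec_assoc[symmetric] connector_mult)
  also have "\<dots> = q * (S' \<odot>v v) n"
    using rf P by (simp add: smat_vec_assoc q smat_vec_mult_poly)
  finally show ?thesis by simp
qed

text \<open>The connector is upper triangular with \<open>p\<close> superdiagonals, which leaves
  \<open>p + 1\<close> terms.\<close>

lemma gauss_borel_connector_vec:
  assumes g: "gauss_borel g S H St" and g': "gauss_borel g' S' H' St'"
    and P: "unibanded p P" and Pg: "g' = P \<odot> g" and q: "P \<odot>v v = (\<lambda>k. q * v k)"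
  shows "q * (S' \<odot>v v) n = (\<Sum>m = n..n + p. smult (connector S P S' n m) ((S \<odot>v v) m))"
proof -
  have U: "unibanded 0 S" "unibanded 0 S'"
    using g g' by (simp_all add: gauss_borel_def lower_unitriangular_iff_unibanded)
  have "q * (S' \<odot>v v) n = (connector S P S' \<odot>v (S \<odot>v v)) n"
    using U P q by (simp add: connector_vec unibanded_row_finite)
  also have "\<dots> = (\<Sum>m = n..n + p. smult (connector S P S' n m) ((S \<odot>v v) m))"
    using gauss_borel_connector_diagonal(2)[OF g g' P Pg] unibanded_connector[OF U(1) P U(2)]
    by (intro smat_vec_eq_sum) (auto simp: unibanded_def not_le)
  finally show ?thesis .
qed

section \<open>Uniqueness of the LU factorization\<close>

text \<open>The unitriangular \<open>M = smat_inv L' \<odot> L\<close> maps \<open>R\<close> to the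
  upper triangular \<open>R'\<close>; column by column, the nonzero diagonal of \<open>R\<close>
  forces \<open>M = smat_one\<close>.\<close>

lemma LU_unique:
  assumes L: "lower_unitriangular L" "lower_unitriangular L'"
    and R: "upper_triangular R" "upper_triangular R'" and D: "\<And>i. R i i \<noteq> 0"
    and eq: "L \<odot> R = L' \<odot> R'"
  shows "L' = L" "R' = R"
proof -
  have U: "unibanded 0 L" "unibanded 0 L'"
    using L by (simp_all add: lower_unitriangular_iff_unibanded)
  note inv = smat_inv_unibanded[OF U(2)]
  have rf: "row_finite L" "row_finite L'" "row_finite (smat_inv L')"
    using U inv by (simp_all add: unibanded_row_finite)
  define M where "M = smat_inv L' \<odot> L"
  have M: "unibanded 0 M"
    using unibanded_mult[OF inv(1) U(1)] by (simp add: M_def)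
  have MR: "M \<odot> R = R'"
    using rf inv by (simp add: M_def smat_mult_assoc eq) (simp add: smat_mult_assoc[symmetric])
  have "M i j = 0" if "j < i" for i j
    using that
  proof (induction j rule: less_induct)
    case (less j)
    \<comment> \<open>\<open>R\<close> cuts the sum off at \<open>k = j\<close>, and the induction
      hypothesis removes the terms with \<open>k < j\<close>.\<close>
    have "0 = (M \<odot> R) i j"
      using R less.prems by (simp add: MR upper_triangular_def)
    also have "\<dots> = (\<Sum>k\<le>j. M i k * R k j)"
      using R by (intro smat_mult_eq_sum) (auto simp: upper_triangular_def)
    also have "{..j} = insert j {..<j}"
      by auto
    also have "(\<Sum>k\<in>insert j {..<j}. M i k * R k j) = M i j * R j j"
      using less by simp
    finally show ?case using D by simp
  qed
  then have M1: "M = smat_one"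
    using M by (intro ext) (auto simp: unibanded_def smat_one_def, metis linorder_neqE_nat)
  then show "R' = R"
    using MR by simp
  have "L' \<odot> M = L"
    using rf inv by (simp add: M_def smat_mult_assoc[symmetric])
  then show "L' = L"
    using M1 by simp
qed

section \<open>Shifts, monomial vectors and moments\<close>

lemma shift_mult: "(shift \<odot> M) i j = M (Suc i) j"
  using smat_mult_eq_sum[of "{Suc i}" shift i M j] by (simp add: shift_def)

lemma shift_vec: "(shift \<odot>v v) i = v (Suc i)"
  using smat_vec_eq_sum[of "{Suc i}" shift i v] by (simp add: shift_def)

lemma row_finite_shift: "row_finite shift"
  using unibanded_shift by (rule unibanded_row_finite)

lemma shift_X: "shift \<odot>v X = (\<lambda>k. monom 1 1 * X k)"
  by (rule ext) (simp add: shift_vec X_def mult_monom)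

text \<open>The power in \<open>X1\<close> grows only at every second index, so multiplying by the
  variable takes two shifts.\<close>

lemma shift2_X1: "(shift \<odot> shift) \<odot>v X1 = (\<lambda>k. monom 1 1 * X1 k)"
  by (rule ext) (simp add: smat_vec_assoc row_finite_shift shift_vec X1_def mult_monom)

lemma shift2_X2: "(shift \<odot> shift) \<odot>v X2 = (\<lambda>k. monom 1 1 * X2 k)"
  by (rule ext) (simp add: smat_vec_assoc row_finite_shift shift_vec X2_def mult_monom)

text \<open>The integrands agree pointwise once the extra factor is absorbed into the row monomial
  \<open>X i\<close>.\<close>

lemma moment_matrix_shift:
  "moment_matrix \<mu> \<Delta> (\<lambda>x. x * w1 x) (\<lambda>x. x * w2 x) = shift \<odot> moment_matrix \<mu> \<Delta> w1 w2"
  by (intro ext)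
    (simp add: shift_mult moment_matrix_def X_def poly_monom algebra_simps)

text \<open>Here the factor is absorbed into \<open>X1 j\<close> and \<open>X2 j\<close> instead,
  which moves the column index by two.\<close>

lemma moment_matrix_shift2:
  "smat_transpose (moment_matrix \<mu> \<Delta> (\<lambda>x. x * w1 x) (\<lambda>x. x * w2 x)) =
     (shift \<odot> shift) \<odot> smat_transpose (moment_matrix \<mu> \<Delta> w1 w2)"
  by (intro ext)
    (simp add: smat_mult_assoc row_finite_shift shift_mult moment_matrix_def smat_transpose_def
      X1_def X2_def poly_monom algebra_simps)

section \<open>Initial values, minors and normalized relations\<close>

lemma smat_vec_at_0:
  assumes "unibanded 0 M"
  shows "(M \<odot>v v) 0 = v 0"
  using smat_vec_eq_sum[of "{0}" M 0 v] assms by (simp add: unibanded_def)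

lemma smat_vec_at_1:
  assumes "unibanded 0 M"
  shows "(M \<odot>v v) 1 = smult (M 1 0) (v 0) + v 1"
  using smat_vec_eq_sum[of "{0, 1}" M 1 v] assms by (simp add: unibanded_def)

lemma det2_eq: "det2 a b c d = a * d - b * c"
  by (simp add: det2_def det_2)

lemma det3_eq:
  "det3 a b c d e f g h i = a * e * i + b * f * g + c * d * h - a * f * h - b * d * i - c * e * g"
  by (simp add: det3_def det_3)

text \<open>Eliminating \<open>a n\<close> and \<open>b n\<close> shows that each minor is
  \<open>\<beta> n\<close> times the next one, so nonvanishing propagates upwards.\<close>

lemma three_term_minors_nonzero:
  fixes a b \<alpha> \<beta> :: "nat \<Rightarrow> real"
  assumes "\<And>n. a n + \<alpha> n * a (n + 1) + \<beta> n * a (n + 2) = 0"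
    and "\<And>n. b n + \<alpha> n * b (n + 1) + \<beta> n * b (n + 2) = 0"
    and "a 0 * b 1 - b 0 * a 1 \<noteq> 0"
  shows "a n * b (n + 1) - b n * a (n + 1) \<noteq> 0"
proof (induction n)
  case (Suc n)
  have "a n = - \<alpha> n * a (n + 1) - \<beta> n * a (n + 2)" "b n = - \<alpha> n * b (n + 1) - \<beta> n * b (n + 2)"
    using assms(1,2)[of n] by linarith+
  then have "a n * b (n + 1) - b n * a (n + 1) =
      \<beta> n * (a (n + 1) * b (n + 2) - b (n + 1) * a (n + 2))"
    by (simp only:) (simp add: algebra_simps)
  with Suc.IH show ?case by auto
qed (use assms(3) in simp)

text \<open>Adapts the relation to type I polynomials, which carry the factor
  \<open>smat_inv H\<close>; the coefficient at \<open>m = n\<close> becomes 1.\<close>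

lemma gauss_borel_connector_normalized_vec:
  assumes g: "gauss_borel g S H St" and g': "gauss_borel g' S' H' St'"
    and P: "unibanded p P" and Pg: "g' = P \<odot> g" and q: "P \<odot>v v = (\<lambda>k. q * v k)"
  shows "q * ((smat_inv H' \<odot> S') \<odot>v v) n =
    (\<Sum>m = n..n + p. smult (connector S P S' n m * H m m / H' n n) (((smat_inv H \<odot> S) \<odot>v v) m))"
proof -
  have D: "nonzero_diagonal H" "nonzero_diagonal H'" and rf: "row_finite S" "row_finite S'"
    using g g' by (simp_all add: gauss_borel_def lower_unitriangular_row_finite)
  have "q * ((smat_inv H' \<odot> S') \<odot>v v) n = smult (1 / H' n n) (q * (S' \<odot>v v) n)"
    using D rf by (simp add: smat_inv_diagonal_mult_vec)
  also have "\<dots> = (\<Sum>m = n..n + p. smult (connector S P S' n m / H' n n) ((S \<odot>v v) m))"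
    by (simp add: gauss_borel_connector_vec[OF assms] smult_sum_right)
  also have "\<dots> = (\<Sum>m = n..n + p. smult (connector S P S' n m * H m m / H' n n)
      (((smat_inv H \<odot> S) \<odot>v v) m))"
    using D rf by (simp add: smat_inv_diagonal_mult_vec nonzero_diagonal_def)
  finally show ?thesis .
qed

lemma sum_three: "(\<Sum>m = n..n + 2. f m) = f n + f (n + 1) + f (n + 2)"
  for f :: "nat \<Rightarrow> 'a::comm_monoid_add"
  by (simp add: numeral_2_eq_2 ac_simps)

section \<open>Determinantal formulas and exchange of the LU factors\<close>

theorem theorem9:
  fixes \<Delta> :: "real set" and \<mu> :: "real measure"
    and w1 w2 :: "real \<Rightarrow> real"
    and S H St S' H' St' :: smat
  assumes interval: "is_interval \<Delta>"
    and borel_measure: "sets \<mu> = sets borel"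
    and supported: "emeasure \<mu> (- \<Delta>) = 0"
    and moments1: "finite_moments \<mu> \<Delta> w1"
    and moments2: "finite_moments \<mu> \<Delta> w2"
    and gb: "gauss_borel (moment_matrix \<mu> \<Delta> w1 w2) S H St"
    and gb': "gauss_borel (moment_matrix \<mu> \<Delta> (\<lambda>x. x * w1 x) (\<lambda>x. x * w2 x)) S' H' St'"
    and zeros: "\<And>n z. poly (map_poly complex_of_real (typeII S n)) z = 0
                  \<Longrightarrow> z \<in> complex_of_real ` interior \<Delta>"
    and zero_notin: "0 \<notin> interior \<Delta>"
  shows "(\<forall>n. poly (typeII S n) 0 \<noteq> 0 \<and>
            (\<forall>x. x \<noteq> 0 \<longrightarrow>
               poly (typeII S' n) x =
                 1 / x * (det2 (poly (typeII S n) 0) (poly (typeII S n) x)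
                               (poly (typeII S (n + 1)) 0) (poly (typeII S (n + 1)) x)
                          / poly (typeII S n) 0)))
       \<and> (\<forall>n. typeI_minor H St n \<noteq> 0 \<and>
            (\<forall>x\<in>\<Delta>. linear_form (\<lambda>x. x * w1 x) (\<lambda>x. x * w2 x) H' St' n x =
                      linear_form_det w1 w2 H St n x / typeI_minor H St n) \<and>
            (\<forall>x\<in>\<Delta>. x \<noteq> 0 \<longrightarrow>
               linear_form w1 w2 H' St' n x =
                 1 / x * (linear_form_det w1 w2 H St n x / typeI_minor H St n)))
       \<and> (\<forall>\<Omega> \<omega>. lower_unitriangular \<Omega> \<longrightarrow> upper_triangular \<omega> \<longrightarrow>
            recursion_matrix S = \<Omega> \<odot> \<omega> \<longrightarrow> recursion_matrix S' = \<omega> \<odot> \<Omega>)"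
proof -
  define g where "g = moment_matrix \<mu> \<Delta> w1 w2"
  define g' where "g' = moment_matrix \<mu> \<Delta> (\<lambda>x. x * w1 x) (\<lambda>x. x * w2 x)"
  have g: "gauss_borel g S H St" and g': "gauss_borel g' S' H' St'"
    using gb gb' by (simp_all add: g_def g'_def)
  have gT: "gauss_borel (smat_transpose g) St H S" and gT': "gauss_borel (smat_transpose g') St' H' S'"
    using g g' by (simp_all add: gauss_borel_transpose)
  have Pg: "g' = shift \<odot> g"
    unfolding g_def g'_def by (rule moment_matrix_shift)
  have PgT: "smat_transpose g' = (shift \<odot> shift) \<odot> smat_transpose g"
    unfolding g_def g'_def by (rule moment_matrix_shift2)
  have U: "unibanded 0 S" "unibanded 0 S'" "unibanded 0 St" "unibanded 0 St'"
    and D: "nonzero_diagonal H" "nonzero_diagonal H'"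
    using g g' by (simp_all add: gauss_borel_def lower_unitriangular_iff_unibanded)
  have D0: "H i i \<noteq> 0" "H' i i \<noteq> 0" for i
    using D by (simp_all add: nonzero_diagonal_def)
  have shift2: "unibanded 2 (shift \<odot> shift)"
    using unibanded_mult[OF unibanded_shift unibanded_shift] by (simp add: numeral_2_eq_2)
  define K where "K = connector S shift S'"
  have K: "unibanded 1 K"
    unfolding K_def by (rule unibanded_connector[OF U(1) unibanded_shift U(2)])
  note K_diag = gauss_borel_connector_diagonal[OF g g' unibanded_shift Pg, folded K_def]

  \<comment> \<open>At \<open>x = 0\<close> the relation \<open>x B'\<^sub>n = K\<^sub>n\<^sub>n B\<^sub>n + B\<^sub>n\<^sub>+\<^sub>1\<close> determines \<open>K\<^sub>n\<^sub>n\<close>.\<close>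
  have typeII: "\<forall>n. poly (typeII S n) 0 \<noteq> 0 \<and> (\<forall>x. x \<noteq> 0 \<longrightarrow> poly (typeII S' n) x =
      1 / x * (det2 (poly (typeII S n) 0) (poly (typeII S n) x)
        (poly (typeII S (n + 1)) 0) (poly (typeII S (n + 1)) x) / poly (typeII S n) 0))"
  proof (intro allI conjI impI)
    fix n
    show nz: "poly (typeII S n) 0 \<noteq> 0"
    proof
      assume "poly (typeII S n) 0 = 0"
      then have "poly (map_poly complex_of_real (typeII S n)) 0 = 0"
        by (simp add: poly_0_coeff_0 coeff_map_poly)
      from zeros[OF this] show False
        using zero_notin by auto
    qed
    fix x :: real assume x: "x \<noteq> 0"
    have "monom 1 1 * typeII S' n = smult (K n n) (typeII S n) + typeII S (n + 1)"
      using gauss_borel_connector_vec[OF g g' unibanded_shift Pg shift_X, of n] K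
      by (simp add: typeII_def K_def unibanded_def)
    then have conn: "y * poly (typeII S' n) y = K n n * poly (typeII S n) y + poly (typeII S (n + 1)) y" for y
      by (metis poly_add poly_mult poly_smult poly_monom mult_1 power_one_right)
    have "K n n = - poly (typeII S (n + 1)) 0 / poly (typeII S n) 0"
      using conn[of 0] nz by (simp add: field_simps)
    with conn[of x] nz x show "poly (typeII S' n) x =
      1 / x * (det2 (poly (typeII S n) 0) (poly (typeII S n) x)
        (poly (typeII S (n + 1)) 0) (poly (typeII S (n + 1)) x) / poly (typeII S n) 0)"
      by (simp add: det2_eq field_simps)
  qed

  \<comment> \<open>The coefficients of the type I relation; they are the same for \<open>X1\<close>
    and \<open>X2\<close>, hence also valid for the linear forms.\<close>
  define c where "c n m = connector St (shift \<odot> shift) St' n m * H m m / H' n n" for n m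
  have c1: "c n n = 1" for n
    using gauss_borel_connector_diagonal(1)[OF gT gT' shift2 PgT, of n] D0 by (simp add: c_def)
  have conn: "x * poly (((smat_inv H' \<odot> St') \<odot>v v) n) x =
      poly (((smat_inv H \<odot> St) \<odot>v v) n) x + c n (n + 1) * poly (((smat_inv H \<odot> St) \<odot>v v) (n + 1)) x
        + c n (n + 2) * poly (((smat_inv H \<odot> St) \<odot>v v) (n + 2)) x"
    if "(shift \<odot> shift) \<odot>v v = (\<lambda>k. monom 1 1 * v k)" for v n x
    using arg_cong[OF gauss_borel_connector_normalized_vec[OF gT gT' shift2 PgT that, of n],
        of "\<lambda>p. poly p x"] c1[of n]
    unfolding sum_three c_def[symmetric] by (simp add: poly_monom)
  note conn1 = conn[OF shift2_X1, folded typeI_1_def] and conn2 = conn[OF shift2_X2, folded typeI_2_def]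

  have minor: "typeI_minor H St n \<noteq> 0" for n
  proof -
    let ?a = "\<lambda>n. poly (typeI_1 H St n) 0" and ?b = "\<lambda>n. poly (typeI_2 H St n) 0"
    have rf: "row_finite St"
      using U by (simp add: unibanded_row_finite)
    \<comment> \<open>Here \<open>?b 0 = 0\<close>, \<open>?a 0 = 1 / H 0 0\<close> and
      \<open>?b 1 = 1 / H 1 1\<close>.\<close>
    have "?a 0 * ?b 1 - ?b 0 * ?a 1 \<noteq> 0"
      using D0[of 0] D0[of 1] smat_vec_at_0[OF U(3)] smat_vec_at_1[OF U(3)]
      by (simp add: typeI_1_def typeI_2_def smat_inv_diagonal_mult_vec[OF D(1) rf] X1_def X2_def)
    \<comment> \<open>\<open>typeI_minor\<close> at \<open>n\<close> uses the rows
      \<open>n + 1\<close> and \<open>n + 2\<close>, hence the index shift.\<close>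
    then have "?a (n + 1) * ?b (n + 1 + 1) - ?b (n + 1) * ?a (n + 1 + 1) \<noteq> 0"
      using conn1[where x = 0] conn2[where x = 0]
      by (intro three_term_minors_nonzero[where \<alpha> = "\<lambda>n. c n (n + 1)" and \<beta> = "\<lambda>n. c n (n + 2)"]) simp_all
    then show ?thesis
      by (simp add: typeI_minor_def det2_eq)
  qed
  \<comment> \<open>Keeping \<open>x\<close> on the left includes \<open>x = 0\<close> and yields
    both forms of the linear form identity.\<close>
  have lin: "x * linear_form w1 w2 H' St' n x = linear_form_det w1 w2 H St n x / typeI_minor H St n"
    for n x
  proof -
    have "x * linear_form w1 w2 H' St' n x =
        w1 x * (x * poly (typeI_1 H' St' n) x) + w2 x * (x * poly (typeI_2 H' St' n) x)"
      by (simp add: linear_form_def algebra_simps)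
    then have Q: "x * linear_form w1 w2 H' St' n x = linear_form w1 w2 H St n x
        + c n (n + 1) * linear_form w1 w2 H St (n + 1) x + c n (n + 2) * linear_form w1 w2 H St (n + 2) x"
      unfolding conn1 conn2 by (simp add: linear_form_def algebra_simps)
    have a: "poly (typeI_1 H St n) 0 =
        - c n (n + 1) * poly (typeI_1 H St (n + 1)) 0 - c n (n + 2) * poly (typeI_1 H St (n + 2)) 0"
      and b: "poly (typeI_2 H St n) 0 =
        - c n (n + 1) * poly (typeI_2 H St (n + 1)) 0 - c n (n + 2) * poly (typeI_2 H St (n + 2)) 0"
      using conn1[of 0 n] conn2[of 0 n] by simp_all
    \<comment> \<open>In terms of row operations: adding \<open>c n (n + 1)\<close> and
      \<open>c n (n + 2)\<close> times the lower rows to the first leaves only its last entry, the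
      perturbed form times \<open>x\<close>.\<close>
    have "linear_form_det w1 w2 H St n x = (x * linear_form w1 w2 H' St' n x) * typeI_minor H St n"
      unfolding linear_form_det_def typeI_minor_def det2_eq det3_eq a b Q by algebra
    then show ?thesis
      using minor[of n] by (simp add: field_simps)
  qed
  have lin': "linear_form (\<lambda>x. x * w1 x) (\<lambda>x. x * w2 x) H' St' n x = x * linear_form w1 w2 H' St' n x"
    for n x
    by (simp add: linear_form_def algebra_simps)

  have LU: "recursion_matrix S' = \<omega> \<odot> \<Omega>"
    if L: "lower_unitriangular \<Omega>" and R: "upper_triangular \<omega>" and T: "recursion_matrix S = \<Omega> \<odot> \<omega>"
    for \<Omega> \<omega>
  proof -
    \<comment> \<open>\<open>M\<close> and \<open>K\<close> are the explicit LU factors of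
      \<open>recursion_matrix S\<close>.\<close>
    define M where "M = S \<odot> smat_inv S'"
    have inv: "unibanded 0 (smat_inv S)" "unibanded 0 (smat_inv S')"
      using U by (simp_all add: smat_inv_unibanded)
    have M: "unibanded 0 M"
      using unibanded_mult[OF U(1) inv(2)] by (simp add: M_def)
    have rf: "row_finite S" "row_finite S'" "row_finite (smat_inv S)" "row_finite (smat_inv S')"
        "row_finite K"
      using U inv K by (simp_all add: unibanded_row_finite)
    note assoc = smat_mult_assoc row_finite_mult row_finite_shift rf
    have cancel: "smat_inv S' \<odot> (S' \<odot> N) = N" "smat_inv S \<odot> (S \<odot> N) = N" for N
      using rf U by (simp_all add: smat_mult_assoc[symmetric] smat_inv_unibanded)
    have MK: "M \<odot> K = recursion_matrix S"
      by (simp add: M_def K_def connector_def recursion_matrix_def assoc cancel)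
    have KM: "K \<odot> M = recursion_matrix S'"
      by (simp add: M_def K_def connector_def recursion_matrix_def assoc cancel)
    have Ku: "upper_triangular K"
      using K_diag(2) by (simp add: upper_triangular_def)
    \<comment> \<open>The diagonal entries are \<open>H' i i / H i i\<close>; being nonzero, they
      let uniqueness identify any given factors with \<open>M\<close> and \<open>K\<close>.\<close>
    have K0: "K i i \<noteq> 0" for i
      using K_diag(1) D0 by simp
    have "M \<odot> K = \<Omega> \<odot> \<omega>"
      using MK T by simp
    from LU_unique[OF M[folded lower_unitriangular_iff_unibanded] L Ku R K0 this]
    have "\<Omega> = M" "\<omega> = K" .
    then show ?thesis
      using KM by simp
  qed

  show ?thesis
    using typeII minor LU by (simp add: lin[symmetric] lin')
qed

end
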